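(* Let $(Y,\|\cdot\|)$ be a Banach space and $K\subseteq Y$ a closed, convex and pointed cone with nonempty interior. Let $\Psi:Y\to\mathbb{R}$ be a continuous and sublinear functional that satisfies the monotonicity property and the representability property with respect to $K$. Then $G:=\partial\Psi(0)$ is a $w^*$-compact generator of $K^*$ and $\Psi=\Psi_G$, that is, $\Psi(y)=\max\{\langle y^*,y\rangle: y^*\in G\}$ for all $y\in Y$.
   Context: Spaces are real; $Y^*$ is the topological dual of $Y$. A cone is a set $C$ with $tx\in C$ for all $x\in C$, $t\ge 0$. $K^*=\{y^*\in Y^*:\langle y^*,y\rangle\ge 0\ \forall y\in K\}$ is the dual cone. Monotonicity property: $\Psi$ is strictly $K$-monotone, i.e. $z-y\in\operatorname{int}(K)\Rightarrow\Psi(y)<\Psi(z)$ (hence, $\Psi$ being continuous, also $z-y\in K\Rightarrow\Psi(y)\le\Psi(z)$). Representability property: $\{y\in Y:\Psi(y)\le 0\}\subseteq -K$ and $\{y\in Y:\Psi(y)<0\}\subseteq-\operatorname{int}(K)$. Sublinear means $\Psi(ty)=t\Psi(y)$ for $t\ge 0$ and $\Psi(y_1+y_2)\le\Psi(y_1)+\Psi(y_2)$. $\partial\Psi(0)=\{y^*\in Y^*:\langle y^*,y\rangle\le\Psi(y)-\Psi(0)\ \forall y\in Y\}$ is the Fenchel subdifferential at $0$. A set $G\subseteq Y^*$ is a generator of $K^*$ (with $Y^*$ carrying the $w^*$-topology) if $G$ is convex, $0$ is not in the $w^*$-closure of $G$, and $K^*=\operatorname{cone}(G):=\{ty^*: t\ge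 0,\ y^*\in G\}$. For a $w^*$-compact generator $G$ of $K^*$, $\Psi_G(y):=\max\{\langle y^*,y\rangle:y^*\in G\}$ is the Drummond–Svaiter functional. *)

theory Defs
  imports "HOL-Analysis.Analysis"
begin

text \<open>
  The topological dual of \<open>'y\<close> is the type \<open>'y \<Rightarrow>\<^sub>L real\<close> of bounded linear functionals.
  For real-valued operators the library's strong operator topology, i.e. the topology of
  pointwise convergence on \<open>'y\<close>, is exactly the weak* topology.
\<close>

abbreviation weak_star :: "('y::real_normed_vector \<Rightarrow>\<^sub>L real) topology" where
  "weak_star \<equiv> strong_operator_topology"

definition pointed :: "'y::real_vector set \<Rightarrow> bool" where
  "pointed K \<longleftrightarrow> K \<inter> uminus ` K = {0}"

definition dual_cone :: "'y::real_normed_vector set \<Rightarrow> ('y \<Rightarrow>\<^sub>L real) set" where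
  "dual_cone K = {f. \<forall>y\<in>K. 0 \<le> blinfun_apply f y}"

definition generated_cone :: "'a::real_vector set \<Rightarrow> 'a set" where
  "generated_cone G = {t *\<^sub>R g | t g. 0 \<le> t \<and> g \<in> G}"

definition is_generator ::
    "('y::real_normed_vector \<Rightarrow>\<^sub>L real) set \<Rightarrow> ('y \<Rightarrow>\<^sub>L real) set \<Rightarrow> bool" where
  "is_generator G C \<longleftrightarrow>
     convex G \<and> 0 \<notin> weak_star closure_of G \<and> C = generated_cone G"

definition sublinear :: "('y::real_vector \<Rightarrow> real) \<Rightarrow> bool" where
  "sublinear \<Psi> \<longleftrightarrow>
     (\<forall>t\<ge>0. \<forall>y. \<Psi> (t *\<^sub>R y) = t * \<Psi> y) \<and>
     (\<forall>y1 y2. \<Psi> (y1 + y2) \<le> \<Psi> y1 + \<Psi> y2)"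

definition strictly_monotone_wrt ::
    "'y::real_normed_vector set \<Rightarrow> ('y \<Rightarrow> real) \<Rightarrow> bool" where
  "strictly_monotone_wrt K \<Psi> \<longleftrightarrow> (\<forall>y z. z - y \<in> interior K \<longrightarrow> \<Psi> y < \<Psi> z)"

definition representable_wrt ::
    "'y::real_normed_vector set \<Rightarrow> ('y \<Rightarrow> real) \<Rightarrow> bool" where
  "representable_wrt K \<Psi> \<longleftrightarrow>
     {y. \<Psi> y \<le> 0} \<subseteq> uminus ` K \<and> {y. \<Psi> y < 0} \<subseteq> uminus ` interior K"

definition subdifferential_at_0 ::
    "('y::real_normed_vector \<Rightarrow> real) \<Rightarrow> ('y \<Rightarrow>\<^sub>L real) set" where
  "subdifferential_at_0 \<Psi> = {f. \<forall>y. blinfun_apply f y \<le> \<Psi> y - \<Psi> 0}"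

text \<open>
  \<open>Greatest\<close> is the maximum whenever it is attained (as it is for a nonempty weak*-compact
  \<open>G\<close>) and is unspecified otherwise; attainment has to be asserted separately.
\<close>

definition drummond_svaiter ::
    "('y::real_normed_vector \<Rightarrow>\<^sub>L real) set \<Rightarrow> 'y \<Rightarrow> real" where
  "drummond_svaiter G y = (GREATEST r. r \<in> (\<lambda>g. blinfun_apply g y) ` G)"

end

theory Submission
  imports Defs
begin

text \<open>
  A Zorn-minimal sublinear functional is linear, which yields the Hahn-Banach theorem; hence
  \<open>\<Psi>\<close> is the pointwise maximum of its subgradients at \<open>0\<close>. These form a closed subset of the
  compact product of the intervals \<open>[-\<Psi> (-y), \<Psi> y]\<close>. Monotonicity bounds the subgradients away
  from \<open>0\<close> at an interior point of \<open>K\<close>. Finally, if \<open>f\<close> lies in the dual cone then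
  representability gives \<open>f \<le> 0\<close> wherever \<open>\<Psi> \<le> 0\<close>; the multiplier \<open>t = sup {f y / \<Psi> y | \<Psi> y > 0}\<close>
  then satisfies \<open>f \<le> t \<Psi>\<close>, so \<open>f / t\<close> is a subgradient.
\<close>

section \<open>Elementary properties of sublinear functionals\<close>

lemma sublinear_scaleR: "sublinear p \<Longrightarrow> 0 \<le> t \<Longrightarrow> p (t *\<^sub>R x) = t * p x"
  by (simp add: sublinear_def)

lemma sublinear_add: "sublinear p \<Longrightarrow> p (x + y) \<le> p x + p y"
  by (simp add: sublinear_def)

lemma sublinear_zero: "sublinear p \<Longrightarrow> p 0 = 0"
  using sublinear_scaleR[of p 0 0] by simp

lemma sublinear_minus_ge: "sublinear p \<Longrightarrow> - p (- x) \<le> p x"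
  using sublinear_add[of p x "- x"] sublinear_zero[of p] by simp

section \<open>Hahn-Banach theorem for sublinear functionals\<close>

text \<open>Supplies the lower bounds of chains for Zorn's lemma. Subadditivity survives the infimum
  because any two members of a chain can be replaced by the smaller one.\<close>

lemma sublinear_INF:
  fixes C :: "('a::real_vector \<Rightarrow> real) set"
  assumes ne: "C \<noteq> {}" and sub: "\<And>p. p \<in> C \<Longrightarrow> sublinear p"
    and chain: "\<And>p q. p \<in> C \<Longrightarrow> q \<in> C \<Longrightarrow> p \<le> q \<or> q \<le> p"
    and bdd: "\<And>x. bdd_below ((\<lambda>p. p x) ` C)"
  shows "sublinear (\<lambda>x. INF p\<in>C. p x)"
  unfolding sublinear_def
proof (intro conjI allI impI)
  fix t :: real and y :: 'a assume t: "0 \<le> t"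
  have "(INF p\<in>C. p (t *\<^sub>R y)) = (INF p\<in>C. t * p y)"
    using sub t by (intro INF_cong) (auto simp: sublinear_scaleR)
  also have "\<dots> = t * (INF p\<in>C. p y)"
  proof (cases "t = 0")
    case True
    then show ?thesis using ne by simp
  next
    case False
    then have t: "t > 0" using t by simp
    show ?thesis
    proof (rule antisym)
      have "bdd_below ((\<lambda>p. t * p y) ` C)"
        using bdd_below_image_mono[of "\<lambda>x. t * x" "(\<lambda>p. p y) ` C"] bdd[of y] t
        by (simp add: mono_def image_image)
      then have "(INF p\<in>C. t * p y) / t \<le> p y" if "p \<in> C" for p
        using cINF_lower[of "\<lambda>p. t * p y" C p] that t by (simp add: field_simps)
      then have "(INF p\<in>C. t * p y) / t \<le> (INF p\<in>C. p y)"
        using ne by (intro cINF_greatest) auto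
      then show "(INF p\<in>C. t * p y) \<le> t * (INF p\<in>C. p y)"
        using t by (simp add: field_simps)
      show "t * (INF p\<in>C. p y) \<le> (INF p\<in>C. t * p y)"
        using ne t bdd[of y] by (intro cINF_greatest) (auto intro!: mult_left_mono cINF_lower)
    qed
  qed
  finally show "(INF p\<in>C. p (t *\<^sub>R y)) = t * (INF p\<in>C. p y)" .
next
  fix x y :: 'a
  have *: "(INF p\<in>C. p (x + y)) \<le> p x + q y" if pq: "p \<in> C" "q \<in> C" for p q
  proof -
    obtain r where r: "r \<in> C" "r \<le> p" "r \<le> q"
      using chain[OF pq] pq by (metis order_refl)
    have "(INF p\<in>C. p (x + y)) \<le> r (x + y)"
      using r bdd by (intro cINF_lower) auto
    also have "\<dots> \<le> r x + r y"
      using sub r by (intro sublinear_add) auto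
    also have "\<dots> \<le> p x + q y"
      using r by (intro add_mono) (auto simp: le_fun_def)
    finally show ?thesis .
  qed
  \<comment> \<open>The two infima on the right are formed one at a time: first over
    \<open>p\<close> with \<open>q\<close> fixed, then over \<open>q\<close>.\<close>
  have "(INF p\<in>C. p (x + y)) - q y \<le> (INF p\<in>C. p x)" if "q \<in> C" for q
    using ne *[OF _ that] by (intro cINF_greatest) (auto simp: algebra_simps)
  then have "(INF p\<in>C. p (x + y)) - (INF p\<in>C. p x) \<le> (INF p\<in>C. p y)"
    using ne by (intro cINF_greatest) (auto simp: algebra_simps)
  then show "(INF p\<in>C. p (x + y)) \<le> (INF p\<in>C. p x) + (INF p\<in>C. p y)"
    by simp
qed

text \<open>Zorn's lemma for the reversed pointwise order. Every sublinear \<open>q\<close> below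
  \<open>p\<close> satisfies \<open>- p (- x) \<le> q x\<close>, so infima of nonempty chains are
  finite.\<close>

lemma minimal_sublinear_exists:
  fixes p :: "'a::real_vector \<Rightarrow> real"
  assumes p: "sublinear p"
  obtains m where "sublinear m" "m \<le> p" "\<And>q. sublinear q \<Longrightarrow> q \<le> m \<Longrightarrow> q = m"
proof -
  let ?A = "{q. sublinear q \<and> q \<le> p}"
  have "\<exists>m\<in>?A. \<forall>a\<in>?A. m \<ge> a \<longrightarrow> a = m"
  proof (rule predicate_Zorn)
    show "partial_order_on ?A (relation_of (\<ge>) ?A)"
      by (rule partial_order_on_relation_ofI) auto
  next
    fix C assume "C \<in> Chains (relation_of (\<ge>) ?A)"
    then have chain: "q \<le> r \<or> r \<le> q" and A: "q \<in> ?A" if "q \<in> C" "r \<in> C" for q r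
      using that unfolding Chains_def relation_of_def by blast+
    show "\<exists>u\<in>?A. \<forall>a\<in>C. a \<ge> u"
    proof (cases "C = {}")
      case True
      then show ?thesis using p by auto
    next
      case False
      then obtain c where c: "c \<in> C" by blast
      have "- p (- x) \<le> q x" if "q \<in> C" for q x
      proof -
        have "sublinear q" "q (- x) \<le> p (- x)"
          using A[OF that that] by (auto simp: le_fun_def)
        then show ?thesis using sublinear_minus_ge[of q x] by simp
      qed
      then have bdd: "bdd_below ((\<lambda>q. q x) ` C)" for x
        by (intro bdd_belowI2[where m = "- p (- x)"]) auto
      have lower: "(\<lambda>x. INF q\<in>C. q x) \<le> q" if "q \<in> C" for q
        using that bdd by (auto simp: le_fun_def intro!: cINF_lower)
      have "sublinear (\<lambda>x. INF q\<in>C. q x)"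
        using False A chain bdd by (intro sublinear_INF) auto
      moreover have "(\<lambda>x. INF q\<in>C. q x) \<le> p"
        using lower[OF c] A[OF c c] by auto
      ultimately show ?thesis
        using lower by blast
    qed
  qed
  then obtain m where m: "m \<in> ?A" "\<And>a. a \<in> ?A \<Longrightarrow> a \<le> m \<Longrightarrow> a = m" by blast
  show ?thesis
    using m by (intro that[of m]) (auto intro: order_trans)
qed

text \<open>
  Taking for \<open>p\<close> a minimal functional forces linearity; evaluating at \<open>x = -v\<close> gives
  \<open>q (- v) \<le> - p v\<close>, so that a linear functional below \<open>q\<close> attains \<open>p\<close> at \<open>v\<close>.
\<close>

lemma sublinear_directional:
  fixes p :: "'a::real_vector \<Rightarrow> real"
  assumes p: "sublinear p"
  obtains q where "sublinear q" "q \<le> p" "\<And>x. q x \<le> p (x + v) - p v"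
proof -
  let ?h = "\<lambda>x t. p (x + t *\<^sub>R v) - t * p v"
  \<comment> \<open>The value \<open>t = 0\<close> gives \<open>q \<le> p\<close>, and
    \<open>t = 1\<close> gives the directional bound.\<close>
  define q where "q = (\<lambda>x. INF t\<in>{0..}. ?h x t)"
  have lb: "- p (- x) \<le> ?h x t" if "t \<ge> 0" for x t
    using sublinear_add[OF p, of "x + t *\<^sub>R v" "- x"] sublinear_scaleR[OF p that, of v]
    by simp
  have bdd: "bdd_below (?h x ` {0..})" for x
    by (intro bdd_belowI2[where m = "- p (- x)"]) (use lb in auto)
  have low: "q x \<le> ?h x t" if "t \<ge> 0" for x t
    unfolding q_def using that bdd by (intro cINF_lower) auto
  have greatest: "c \<le> q x" if "\<And>t. t \<ge> 0 \<Longrightarrow> c \<le> ?h x t" for c x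
    unfolding q_def using that by (intro cINF_greatest) auto
  \<comment> \<open>Rescaling the parameter to \<open>t / s\<close> gives one inequality of
    homogeneity; the other follows by applying it to \<open>inverse s\<close> and
    \<open>s *\<^sub>R x\<close>.\<close>
  have scale_le: "s * q x \<le> q (s *\<^sub>R x)" if "s > 0" for s x
  proof (rule greatest)
    fix t :: real assume "t \<ge> 0"
    then have "q x \<le> ?h x (t / s)" using that by (intro low) auto
    then have "s * q x \<le> s * p (x + (t / s) *\<^sub>R v) - t * p v"
      using that by (simp add: field_simps)
    also have "s * p (x + (t / s) *\<^sub>R v) = p (s *\<^sub>R x + t *\<^sub>R v)"
      using that sublinear_scaleR[OF p, of s "x + (t / s) *\<^sub>R v"] by (simp add: scaleR_add_right)
    finally show "s * q x \<le> ?h (s *\<^sub>R x) t" .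
  qed
  have "q 0 = 0"
  proof (rule antisym)
    show "q 0 \<le> 0" using low[of 0 0] sublinear_zero[OF p] by simp
    show "0 \<le> q 0"
      by (intro greatest) (auto simp: sublinear_scaleR[OF p])
  qed
  moreover have "q (s *\<^sub>R x) = s * q x" if "s > 0" for s x
  proof (rule antisym)
    have "inverse s * q (s *\<^sub>R x) \<le> q (inverse s *\<^sub>R s *\<^sub>R x)"
      using that by (intro scale_le) auto
    then show "q (s *\<^sub>R x) \<le> s * q x"
      using that by (simp add: field_simps)
  qed (use scale_le that in auto)
  ultimately have "q (s *\<^sub>R x) = s * q x" if "s \<ge> 0" for s x
    using that by (cases "s = 0") auto
  moreover have "q (x + y) \<le> q x + q y" for x y
  proof -
    have *: "q (x + y) \<le> ?h x s + ?h y t" if "s \<ge> 0" "t \<ge> 0" for s t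
    proof -
      have "q (x + y) \<le> ?h (x + y) (s + t)"
        using that by (intro low) auto
      also have "\<dots> \<le> ?h x s + ?h y t"
        using sublinear_add[OF p, of "x + s *\<^sub>R v" "y + t *\<^sub>R v"]
        by (simp add: algebra_simps)
      finally show ?thesis .
    qed
    have "q (x + y) - ?h y t \<le> q x" if "t \<ge> 0" for t
      using *[OF _ that] by (intro greatest) (auto simp: algebra_simps)
    then have "q (x + y) - q x \<le> q y"
      by (intro greatest) (auto simp: algebra_simps)
    then show ?thesis by simp
  qed
  ultimately have "sublinear q"
    by (simp add: sublinear_def)
  then show ?thesis
    using low[of 0] low[of 1] by (intro that[of q]) (auto simp: le_fun_def)
qed

text \<open>Minimality identifies \<open>m\<close> with its directional functional for
  \<open>v\<close>, so \<open>m x + m v \<le> m (x + v)\<close>, the converse of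
  subadditivity.\<close>

lemma minimal_sublinear_linear:
  fixes m :: "'a::real_vector \<Rightarrow> real"
  assumes m: "sublinear m" and min: "\<And>q. sublinear q \<Longrightarrow> q \<le> m \<Longrightarrow> q = m"
  shows "linear m"
proof -
  have add: "m (x + v) = m x + m v" for x v
  proof -
    obtain q where "sublinear q" "q \<le> m" "\<And>x. q x \<le> m (x + v) - m v"
      using sublinear_directional[OF m, of v] by blast
    then have "m x \<le> m (x + v) - m v" using min by metis
    then show ?thesis using sublinear_add[OF m, of x v] by simp
  qed
  have neg: "m (- x) = - m x" for x
    using add[of x "- x"] sublinear_zero[OF m] by simp
  have "m (r *\<^sub>R x) = r * m x" for r x
    using sublinear_scaleR[OF m, of r x] sublinear_scaleR[OF m, of "- r" x] neg[of "r *\<^sub>R x"]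
    by (cases "r \<ge> 0") auto
  then show ?thesis
    using add by (intro linearI) auto
qed

theorem sublinear_supporting_linear:
  fixes p :: "'a::real_vector \<Rightarrow> real"
  assumes p: "sublinear p"
  obtains f where "linear f" "f \<le> p" "f v = p v"
proof -
  obtain q where q: "sublinear q" "q \<le> p" "\<And>x. q x \<le> p (x + v) - p v"
    using sublinear_directional[OF p, of v] by blast
  obtain f where f: "sublinear f" "f \<le> q" "\<And>r. sublinear r \<Longrightarrow> r \<le> f \<Longrightarrow> r = f"
    using minimal_sublinear_exists[OF q(1)] by blast
  have lin: "linear f"
    using f by (intro minimal_sublinear_linear) auto
  have "f (- v) \<le> - p v"
    using f(2) q(3)[of "- v"] sublinear_zero[OF p] by (force simp: le_fun_def intro: order_trans)
  moreover have le: "f \<le> p"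
    using f(2) q(2) by auto
  ultimately have "f v = p v"
    using linear_neg[OF lin, of v] by (auto simp: le_fun_def intro: antisym)
  then show ?thesis
    using that lin le by blast
qed

section \<open>The subdifferential at the origin\<close>

text \<open>Continuity of \<open>p\<close> at the origin bounds \<open>f\<close> above by 1 on a
  small ball. Homogeneity makes this a global bound, and linearity makes it two-sided via
  \<open>- x\<close>.\<close>

lemma linear_le_sublinear_bounded:
  fixes p :: "'a::real_normed_vector \<Rightarrow> real"
  assumes p: "sublinear p" "continuous_on UNIV p" and f: "linear f" "f \<le> p"
  shows "bounded_linear f"
proof -
  have "isCont p 0"
    using p(2) by (simp add: continuous_on_eq_continuous_at)
  then obtain d where d: "d > 0" "\<And>x. dist x 0 < d \<Longrightarrow> dist (p x) (p 0) < 1"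
    unfolding continuous_at_eps_delta by (metis zero_less_one)
  have bound: "f x \<le> norm x * (2 / d)" for x
  proof (cases "x = 0")
    case True
    then show ?thesis using linear_0[OF f(1)] by simp
  next
    case False
    \<comment> \<open>The scaled vector has norm \<open>d / 2\<close>, strictly inside the
      ball.\<close>
    let ?c = "d / (2 * norm x)"
    have c: "?c > 0" using d False by simp
    have "norm (?c *\<^sub>R x) < d" using d False by simp
    then have "p (?c *\<^sub>R x) < 1"
      using d(2)[of "?c *\<^sub>R x"] sublinear_zero[OF p(1)] by (simp add: dist_real_def)
    moreover have "f (?c *\<^sub>R x) \<le> p (?c *\<^sub>R x)"
      using f(2) by (simp add: le_fun_def)
    ultimately have "?c * f x \<le> 1"
      using linear_scale[OF f(1), of ?c x] by simp
    then show ?thesis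
      using d False by (simp add: field_simps)
  qed
  have "\<bar>f x\<bar> \<le> norm x * (2 / d)" for x
    using bound[of x] bound[of "- x"] linear_neg[OF f(1), of x] by (simp add: abs_le_iff)
  then show ?thesis
    using linear_add[OF f(1)] linear_scale[OF f(1)]
    by (intro bounded_linear_intro[where K = "2 / d"]) auto
qed

lemma subdifferential_at_0_sublinear:
  "sublinear p \<Longrightarrow> subdifferential_at_0 p = {f. \<forall>y. blinfun_apply f y \<le> p y}"
  by (simp add: subdifferential_at_0_def sublinear_zero)

lemma subdifferential_at_0_attains:
  assumes p: "sublinear p" "continuous_on UNIV p"
  obtains f where "f \<in> subdifferential_at_0 p" "blinfun_apply f y = p y"
proof -
  obtain f where f: "linear f" "f \<le> p" "f y = p y"
    using sublinear_supporting_linear[OF p(1)] by blast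
  then have "bounded_linear f"
    using p linear_le_sublinear_bounded by blast
  then show ?thesis
    using f that[of "Blinfun f"]
    by (simp add: subdifferential_at_0_sublinear[OF p(1)] bounded_linear_Blinfun_apply le_fun_def)
qed

text \<open>A Banach-Alaoglu argument: compactness is obtained in the product space of all functions
  and transported along \<open>Blinfun\<close>. Linear functions below \<open>p\<close> are
  automatically bounded, so closed pointwise conditions describe the whole set.\<close>

lemma compactin_subdifferential_at_0:
  fixes p :: "'a::real_normed_vector \<Rightarrow> real"
  assumes p: "sublinear p" "continuous_on UNIV p"
  shows "compactin weak_star (subdifferential_at_0 p)"
proof -
  let ?S = "{f. linear f \<and> f \<le> p}"
  have Blin: "blinfun_apply (Blinfun f) = f" if "f \<in> ?S" for f
    using that linear_le_sublinear_bounded[OF p] by (simp add: bounded_linear_Blinfun_apply)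
  let ?B = "Pi\<^sub>E UNIV (\<lambda>y. {- p (- y)..p y})"
  have cont: "continuous_on UNIV (\<lambda>f::'a \<Rightarrow> real. f y)" for y
    by simp
  \<comment> \<open>Functions carry the product topology, so each single equation constrains
    finitely many coordinates and is closed.\<close>
  have "closed {f::'a \<Rightarrow> real. \<forall>x y. f (x + y) = f x + f y}"
    by (intro closed_Collect_all closed_Collect_eq continuous_on_add cont)
  moreover have "closed {f::'a \<Rightarrow> real. \<forall>r x. f (r *\<^sub>R x) = r * f x}"
    by (intro closed_Collect_all closed_Collect_eq continuous_on_mult continuous_on_const cont)
  ultimately have "closed {f::'a \<Rightarrow> real. linear f}"
    by (simp add: linear_iff closed_Collect_conj)
  moreover have "closed {f. f \<le> p}"
    unfolding le_fun_def
    by (intro closed_Collect_all closed_Collect_le continuous_on_const cont)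
  ultimately have closed: "closed ?S"
    by (rule closed_Collect_conj)
  \<comment> \<open>Tychonoff's theorem.\<close>
  have "compactin (product_topology (\<lambda>i. euclidean) UNIV) ?B"
    by (subst compactin_PiE) auto
  then have "compact ?B"
    by (simp add: euclidean_product_topology)
  moreover have "?S \<subseteq> ?B"
  proof
    fix f assume f: "f \<in> ?S"
    have "- p (- y) \<le> f y" for y
    proof -
      have "f (- y) \<le> p (- y)" using f by (simp add: le_fun_def)
      then show ?thesis using f linear_neg[of f y] by simp
    qed
    then show "f \<in> ?B" using f by (auto simp: le_fun_def)
  qed
  ultimately have "compact ?S"
    using closed compact_Int_closed[of ?B ?S] by (simp add: Int_absorb1)
  then have "compactin (subtopology euclidean ?S) ?S"
    by (simp add: compactin_subtopology)
  \<comment> \<open>Continuity into the weak* topology is checked at each point \<open>y\<close>,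
    where on \<open>?S\<close> the map is just a coordinate projection.\<close>
  moreover have "continuous_map (subtopology euclidean ?S) weak_star Blinfun"
  proof (subst continuous_on_strong_operator_topo_iff_coordinatewise, intro allI)
    fix y
    have "continuous_map (subtopology euclidean ?S) euclidean (\<lambda>f. f y)"
      using continuous_on_subset[OF cont subset_UNIV] by simp
    then show "continuous_map (subtopology euclidean ?S) euclidean (\<lambda>f. blinfun_apply (Blinfun f) y)"
      by (rule continuous_map_eq) (use Blin in auto)
  qed
  ultimately have "compactin weak_star (Blinfun ` ?S)"
    by (rule image_compactin)
  moreover have "Blinfun ` ?S = subdifferential_at_0 p"
  proof (intro equalityI subsetI)
    fix g assume "g \<in> Blinfun ` ?S"
    then show "g \<in> subdifferential_at_0 p"
      using Blin by (auto simp: subdifferential_at_0_sublinear[OF p(1)] le_fun_def)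
  next
    fix g assume "g \<in> subdifferential_at_0 p"
    then have "blinfun_apply g \<in> ?S"
      by (auto simp: subdifferential_at_0_sublinear[OF p(1)] le_fun_def
          intro: bounded_linear.linear blinfun.bounded_linear_right)
    then show "g \<in> Blinfun ` ?S"
      using blinfun_apply_inverse[of g] by (metis imageI)
  qed
  ultimately show ?thesis by simp
qed

lemma convex_subdifferential_at_0: "convex (subdifferential_at_0 p)"
proof (rule convexI)
  fix f g and u v :: real
  assume *: "f \<in> subdifferential_at_0 p" "g \<in> subdifferential_at_0 p" "0 \<le> u" "0 \<le> v" "u + v = 1"
  have "u * blinfun_apply f y + v * blinfun_apply g y \<le> p y - p 0" for y
    using * by (intro convex_bound_le) (auto simp: subdifferential_at_0_def)
  then show "u *\<^sub>R f + v *\<^sub>R g \<in> subdifferential_at_0 p"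
    by (simp add: subdifferential_at_0_def blinfun.add_left blinfun.scaleR_left)
qed

text \<open>Evaluation at \<open>e\<close> is weak* continuous, so a closed half-space contains
  \<open>G\<close> and excludes 0.\<close>

lemma zero_notin_weak_star_closure:
  assumes "c > 0" "\<And>f. f \<in> G \<Longrightarrow> c \<le> blinfun_apply f e"
  shows "0 \<notin> weak_star closure_of G"
proof -
  have "closedin weak_star {f \<in> topspace weak_star. blinfun_apply f e \<in> {c..}}"
    by (rule closedin_continuous_map_preimage[OF strong_operator_topology_continuous_evaluation]) simp
  then have "weak_star closure_of G \<subseteq> {f \<in> topspace weak_star. blinfun_apply f e \<in> {c..}}"
    using assms(2) by (intro closure_of_minimal) (auto simp: strong_operator_topology_topspace)
  then show ?thesis
    using assms(1) by auto
qed

section \<open>The dual cone\<close>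

text \<open>A Farkas lemma; the Slater point \<open>z\<close> makes the supremum that defines the multiplier finite.\<close>

lemma sublinear_Farkas:
  fixes f p :: "'a::real_vector \<Rightarrow> real"
  assumes p: "sublinear p" and f: "linear f" and z: "p z < 0"
    and imp: "\<And>y. p y \<le> 0 \<Longrightarrow> f y \<le> 0" and nz: "f v > 0"
  obtains t where "t > 0" "\<And>y. f y \<le> t * p y"
proof -
  let ?P = "{y. p y > 0}"
  define t where "t = (SUP y\<in>?P. f y / p y)"
  have cross: "f y / p y \<le> f w / p w" if "p y > 0" "p w < 0" for y w
  proof -
    \<comment> \<open>The weights normalise the values of \<open>p\<close> to 1 and -1, so that they
      cancel in the subadditivity bound.\<close>
    let ?x = "(1 / p y) *\<^sub>R y + (1 / (- p w)) *\<^sub>R w"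
    have "p ?x \<le> p ((1 / p y) *\<^sub>R y) + p ((1 / (- p w)) *\<^sub>R w)"
      by (rule sublinear_add[OF p])
    also have "\<dots> = 0"
      using that by (simp add: sublinear_scaleR[OF p] del: scaleR_minus_left)
    finally have "f ?x \<le> 0" by (rule imp)
    moreover have "f ?x = f y / p y - f w / p w"
      using f by (simp add: linear_add linear_scale linear_neg linear_diff)
    ultimately show ?thesis by simp
  qed
  have bdd: "bdd_above ((\<lambda>y. f y / p y) ` ?P)"
    by (intro bdd_aboveI2[where M = "f z / p z"]) (use cross z in auto)
  have v: "p v > 0" using imp nz by (meson not_less)
  have up: "f y / p y \<le> t" if "p y > 0" for y
    unfolding t_def using that bdd by (intro cSUP_upper) auto
  have "t > 0"
    using up[OF v] nz v by (smt (verit) divide_pos_pos)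
  moreover have "f y \<le> t * p y" for y
  \<comment> \<open>For negative \<open>p y\<close>, division reverses the inequality and the claim
    becomes \<open>t \<le> f y / p y\<close>, which is \<open>cross\<close> after taking the
    supremum.\<close>
  proof (cases "p y" "0::real" rule: linorder_cases)
    case less
    then have "t \<le> f y / p y"
      unfolding t_def using v cross by (intro cSUP_least) auto
    then show ?thesis using less by (simp add: field_simps)
  next
    case equal
    then show ?thesis using imp[of y] by simp
  next
    case greater
    then show ?thesis using up[of y] by (simp add: field_simps)
  qed
  ultimately show ?thesis using that by blast
qed

text \<open>The translate of the scaled interior is an open subset of \<open>K\<close>.\<close>

lemma convex_cone_add_interior:
  fixes K :: "'a::real_normed_vector set"
  assumes "convex K" "cone K" "k \<in> K" "e \<in> interior K" "t > 0"
  shows "k + t *\<^sub>R e \<in> interior K"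
proof -
  let ?U = "(+) k ` ((*\<^sub>R) t ` interior K)"
  have "open ?U"
    using assms by (intro open_translation open_scaling) auto
  moreover have "?U \<subseteq> K"
    using assms convex_cone[of K] interior_subset[of K] by (auto simp: subset_iff)
  ultimately have "?U \<subseteq> interior K"
    by (intro interior_maximal)
  then show ?thesis using assms by auto
qed

text \<open>Approximating \<open>- k\<close> by the points \<open>- (k + t *\<^sub>R e)\<close>,
  where \<open>p\<close> is negative, gives \<open>p (- k) < t * p e\<close> for all
  \<open>t > 0\<close>.\<close>

lemma strictly_monotone_nonpos:
  fixes K :: "'a::real_normed_vector set"
  assumes "convex K" "cone K" "interior K \<noteq> {}" "sublinear p" "strictly_monotone_wrt K p" "k \<in> K"
  shows "p (- k) \<le> 0"
proof (rule ccontr)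
  assume neg: "\<not> ?thesis"
  obtain e where e: "e \<in> interior K" using assms by blast
  have neg_int: "p (- x) < 0" if "x \<in> interior K" for x
    using assms(5) that sublinear_zero[OF assms(4)]
    unfolding strictly_monotone_wrt_def by (metis diff_0 minus_minus diff_minus_eq_add add_0)
  have lt: "p (- k) < t * p e" if "t > 0" for t
  proof -
    have "p (- (k + t *\<^sub>R e)) < 0"
      using assms e that by (intro neg_int convex_cone_add_interior)
    moreover have "p (- k) \<le> p (- (k + t *\<^sub>R e)) + p (t *\<^sub>R e)"
      using sublinear_add[OF assms(4), of "- (k + t *\<^sub>R e)" "t *\<^sub>R e"] by simp
    ultimately show ?thesis
      using sublinear_scaleR[OF assms(4), of t e] that by simp
  qed
  have "p e > 0" using lt[of 1] neg by simp
  \<comment> \<open>This \<open>t\<close> turns the bound into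
    \<open>p (- k) < p (- k)\<close>.\<close>
  then show False using lt[of "p (- k) / p e"] neg by simp
qed

text \<open>Representability and the Farkas multiplier give one inclusion. For the other, a
  subgradient lies below \<open>p\<close>, hence is nonpositive on \<open>- K\<close>.\<close>

lemma dual_cone_eq_generated_cone_subdifferential:
  fixes K :: "'a::real_normed_vector set"
  assumes K: "convex K" "cone K" "interior K \<noteq> {}"
    and p: "sublinear p" "continuous_on UNIV p"
    and mono: "strictly_monotone_wrt K p" and rep: "{y. p y \<le> 0} \<subseteq> uminus ` K"
    and z: "p z < 0"
  shows "dual_cone K = generated_cone (subdifferential_at_0 p)"
proof (intro equalityI subsetI)
  fix f assume f: "f \<in> dual_cone K"
  show "f \<in> generated_cone (subdifferential_at_0 p)"
  proof (cases "f = 0")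
    case True
    \<comment> \<open>The zero functional is 0 times any subgradient, so nonemptiness
      suffices.\<close>
    obtain g where "g \<in> subdifferential_at_0 p"
      using subdifferential_at_0_attains[OF p] by blast
    then show ?thesis
      unfolding generated_cone_def True by (force intro: exI[of _ "0::real"])
  next
    case False
    then obtain x where "blinfun_apply f x \<noteq> 0"
      by (metis blinfun_eqI zero_blinfun.rep_eq)
    then obtain v where v: "blinfun_apply f v > 0"
      by (metis blinfun.minus_right linorder_neqE_linordered_idom neg_0_less_iff_less)
    have imp: "blinfun_apply f y \<le> 0" if "p y \<le> 0" for y
      using rep f that by (force simp: dual_cone_def blinfun.minus_right)
    obtain t where t: "t > 0" "\<And>y. blinfun_apply f y \<le> t * p y"
      using sublinear_Farkas[OF p(1) bounded_linear.linear[OF blinfun.bounded_linear_right] z imp v]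
      by blast
    have "inverse t *\<^sub>R f \<in> subdifferential_at_0 p"
      using t by (auto simp: subdifferential_at_0_sublinear[OF p(1)] blinfun.scaleR_left field_simps)
    moreover have "f = t *\<^sub>R inverse t *\<^sub>R f"
      using t by simp
    ultimately show ?thesis
      unfolding generated_cone_def using t(1) by (smt (verit) mem_Collect_eq)
  qed
next
  fix f assume "f \<in> generated_cone (subdifferential_at_0 p)"
  then obtain t g where g: "f = t *\<^sub>R g" "0 \<le> t" "\<And>y. blinfun_apply g y \<le> p y"
    by (auto simp: generated_cone_def subdifferential_at_0_sublinear[OF p(1)])
  have "0 \<le> blinfun_apply g k" if "k \<in> K" for k
    using g(3)[of "- k"] strictly_monotone_nonpos[OF K p(1) mono that]
    by (simp add: blinfun.minus_right)
  then show "f \<in> dual_cone K"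
    using g by (simp add: dual_cone_def blinfun.scaleR_left)
qed

text \<open>The last conjunct records attainment, which an equation with a \<open>GREATEST\<close>
  term does not assert by itself.\<close>

theorem theorem4p5:
  fixes K :: "'y::banach set" and \<Psi> :: "'y \<Rightarrow> real"
  assumes "closed K" and "convex K" and "cone K" and "pointed K" and "interior K \<noteq> {}"
    and "continuous_on UNIV \<Psi>" and "sublinear \<Psi>"
    and "strictly_monotone_wrt K \<Psi>" and "representable_wrt K \<Psi>"
  shows "compactin weak_star (subdifferential_at_0 \<Psi>) \<and>
         is_generator (subdifferential_at_0 \<Psi>) (dual_cone K) \<and>
         \<Psi> = drummond_svaiter (subdifferential_at_0 \<Psi>) \<and>
         (\<forall>y. (\<exists>f\<in>subdifferential_at_0 \<Psi>. blinfun_apply f y = \<Psi> y) \<and>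
              (\<forall>f\<in>subdifferential_at_0 \<Psi>. blinfun_apply f y \<le> \<Psi> y))"
proof -
  let ?G = "subdifferential_at_0 \<Psi>"
  have att: "\<exists>f\<in>?G. blinfun_apply f y = \<Psi> y" for y
    using subdifferential_at_0_attains[OF assms(7,6), of y] by blast
  have le: "blinfun_apply f y \<le> \<Psi> y" if "f \<in> ?G" for f y
    using that by (simp add: subdifferential_at_0_sublinear[OF assms(7)])
  \<comment> \<open>The point \<open>- e\<close> serves twice: as the Slater point for the
    multiplier, and for the uniform bound \<open>- \<Psi> (- e) \<le> f e\<close> on
    subgradients.\<close>
  obtain e where "e \<in> interior K" using assms(5) by blast
  then have "0 - (- e) \<in> interior K" by simp
  then have e: "\<Psi> (- e) < 0"
    using assms(8) sublinear_zero[OF assms(7)] unfolding strictly_monotone_wrt_def by metis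
  have "0 \<notin> weak_star closure_of ?G"
  proof (rule zero_notin_weak_star_closure)
    show "- \<Psi> (- e) \<le> blinfun_apply f e" if "f \<in> ?G" for f
      using le[OF that, of "- e"] by (simp add: blinfun.minus_right)
  qed (use e in simp)
  moreover have "dual_cone K = generated_cone ?G"
    using assms e
    by (intro dual_cone_eq_generated_cone_subdifferential) (auto simp: representable_wrt_def)
  ultimately have "is_generator ?G (dual_cone K)"
    by (simp add: is_generator_def convex_subdifferential_at_0)
  moreover have "drummond_svaiter ?G y = \<Psi> y" for y
    unfolding drummond_svaiter_def
    by (intro Greatest_equality) (use att[of y] le in \<open>force simp: image_iff\<close>)+
  ultimately show ?thesis
    using compactin_subdifferential_at_0[OF assms(7,6)] att le by (auto simp: fun_eq_iff)
qed

end
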